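(* Let $k\geq 2$ be an integer and let $(v_n)_{n\geq 0}$ be a $k$-regular sequence with values in $\mathbb{C}$. Then the Dirichlet series $\sum_{n\geq 1}v_n n^{-s}$ is the first component of a vector $G(s)$ of Dirichlet series (converging in some right half-plane) such that $G$ has an analytic continuation to a meromorphic function on the whole complex plane, whose poles (if any) are located on a finite number of left semi-lattices.
   Context: A sequence $(s(n))_{n\geq 0}$ with values in a $\mathbb{Z}$-module $R$ (here $R=\mathbb{C}$) is $k$-regular if its $k$-kernel $\{(s(k^l n+r))_{n\geq 0}: l\geq 0,\ 0\leq r<k^l\}$ is contained in the $\mathbb{Z}$-linear span of finitely many sequences over $R$. A left semi-lattice is a subset of $\mathbb{C}$ of the form $\{w+icm-l: m\in\mathbb{Z},\ l\in\mathbb{Z}_{\geq 0}\}$ for some $w\in\mathbb{C}$ and $c>0$. *)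

theory Defs
  imports "HOL-Complex_Analysis.Complex_Analysis"
begin

definition k_kernel :: "nat \<Rightarrow> (nat \<Rightarrow> 'a) \<Rightarrow> (nat \<Rightarrow> 'a) set" where
  "k_kernel k s = {(\<lambda>n. s (k ^ l * n + r)) | l r. r < k ^ l}"

definition int_span :: "(nat \<Rightarrow> complex) set \<Rightarrow> (nat \<Rightarrow> complex) set" where
  "int_span B = {(\<lambda>n. \<Sum>b\<in>B. of_int (c b) * b n) | c :: (nat \<Rightarrow> complex) \<Rightarrow> int. True}"
  \<comment> \<open>the \<open>\<int>\<close>-linear span, only meaningful for finite \<open>B\<close>\<close>

definition k_regular :: "nat \<Rightarrow> (nat \<Rightarrow> complex) \<Rightarrow> bool" where
  "k_regular k s \<longleftrightarrow> (\<exists>B. finite B \<and> k_kernel k s \<subseteq> int_span B)"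

definition left_semi_lattice :: "complex set \<Rightarrow> bool" where
  "left_semi_lattice L \<longleftrightarrow>
     (\<exists>(w :: complex) (c :: real). c > 0 \<and>
        L = {w + \<i> * of_real c * of_int m - of_nat l | (m :: int) (l :: nat). True})"

text \<open>
  A family \<open>V 0, V 1, \<dots>\<close> of vectors in \<open>\<complex>\<^sup>d\<close> is encoded by its components: \<open>V n j\<close> with \<open>j < d\<close>.
\<close>
definition dirichlet_vector ::
  "nat \<Rightarrow> (nat \<Rightarrow> nat \<Rightarrow> complex) \<Rightarrow> (complex \<Rightarrow> nat \<Rightarrow> complex) \<Rightarrow> bool" where
  "dirichlet_vector d V G \<longleftrightarrow>
     (\<exists>\<sigma> :: real. \<forall>s. Re s > \<sigma> \<longrightarrow>
        (\<forall>j<d. (\<lambda>n. V (Suc n) j * of_nat (Suc n) powr (- s)) sums G s j))"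

end

(*
  The kernel of a regular sequence spans a finite-dimensional space W of sequences that is stable
  under the decimations f |-> f(k n + r), which forces polynomial growth on W.  Splitting
  D_f(s) = sum f(n) n^{-s} by residues mod k and expanding (k n + r)^{-s} binomially in r/(k n) gives

    D_f(s) = k^{-s} D_{T f}(s) + (terms in D_g(s + j), g in W, j >= 1) + (remainder),

  where T f(n) = sum_{r < k} f(k n + r) and the remainder is holomorphic further to the left.
  The shifted terms are already continued one unit further left.  If p(T) f = 0 and z is a root
  of p, then D_{T f} = z D_f + D_g with g = (T - z) f killed by a polynomial of smaller degree, so that
  (1 - z k^{-s}) D_f(s) continues as well.  New poles therefore have k^s equal to a nonzero
  root z, and the shifts by j fill these vertical progressions out to left semi-lattices.
*)
theory Submission
  imports Defs "HOL-Library.Function_Algebras"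
    "HOL-Computational_Algebra.Fundamental_Theorem_Algebra"
begin

section \<open>Dirichlet series of polynomially bounded sequences\<close>

definition half_plane :: "real \<Rightarrow> complex set" where
  "half_plane a = {s. Re s > a}"

lemma half_plane_open [simp]: "open (half_plane a)"
  by (simp add: half_plane_def open_halfspace_Re_gt)

lemma half_plane_connected [simp]: "connected (half_plane a)"
  by (simp add: half_plane_def convex_connected convex_halfspace_Re_gt)

text \<open>The term at \<open>n = 0\<close> vanishes because \<open>0 powr z = 0\<close>.\<close>
definition dirichlet_series :: "(nat \<Rightarrow> complex) \<Rightarrow> complex \<Rightarrow> complex" where
  "dirichlet_series f s = (\<Sum>n. f n * of_nat n powr (-s))"

text \<open>The index 0 is left out because \<open>real 0 ^ A\<close> is 0 for \<open>A > 0\<close>,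
  while \<open>f 0\<close> is arbitrary and does not enter the Dirichlet series.\<close>

definition growth_bound :: "nat \<Rightarrow> (nat \<Rightarrow> complex) \<Rightarrow> bool" where
  "growth_bound A f \<longleftrightarrow> (\<exists>C. \<forall>n\<ge>1. norm (f n) \<le> C * real n ^ A)"

text \<open>Comparison with a real p-series, locally uniformly in \<open>s\<close>. A factor that
  decays like \<open>n ^ -q\<close> moves the half-plane of convergence \<open>q\<close> units to
  the left; \<open>q = 0\<close> gives the Dirichlet series themselves, \<open>q = Suc N\<close> the
  remainders in the functional equation.\<close>

lemma twisted_dirichlet_series:
  fixes \<rho> :: "nat \<Rightarrow> complex \<Rightarrow> complex"
  assumes f: "growth_bound A f"
    and hol: "\<And>n. \<rho> n holomorphic_on UNIV"
    and bnd: "\<And>R. \<exists>M. \<forall>n\<ge>1. \<forall>s. norm s \<le> R \<longrightarrow> norm (\<rho> n s) \<le> M / real n ^ q"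
  defines "a \<equiv> real A + 1 - real q"
  shows "\<And>s. Re s > a \<Longrightarrow> summable (\<lambda>n. f n * of_nat n powr (-s) * \<rho> n s)"
    and "(\<lambda>s. \<Sum>n. f n * of_nat n powr (-s) * \<rho> n s) holomorphic_on half_plane a"
proof -
  obtain C0 where "\<forall>n\<ge>1. norm (f n) \<le> C0 * real n ^ A"
    using f by (auto simp: growth_bound_def)
  moreover have "C0 * real n ^ A \<le> \<bar>C0\<bar> * real n ^ A" for n
    by (intro mult_right_mono) auto
  ultimately have C: "\<And>n. n \<ge> 1 \<Longrightarrow> norm (f n) \<le> \<bar>C0\<bar> * real n ^ A"
    by (meson order_trans)
  let ?t = "\<lambda>n s. f n * of_nat n powr (-s) * \<rho> n s"
  have thol: "?t n holomorphic_on UNIV" for n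
    by (cases "n = 0") (auto intro!: holomorphic_intros hol)
  have loc: "\<exists>d h. 0 < d \<and> summable h \<and>
      (\<forall>\<^sub>F n in sequentially. \<forall>y\<in>ball x d \<inter> half_plane a. norm (?t n y) \<le> h n)"
    if "x \<in> half_plane a" for x
  proof -
    \<comment> \<open>With half the distance to the boundary line as radius, the exponent
      \<open>e\<close> of the majorant becomes \<open>-1 - d\<close>.\<close>
    define d where "d = (Re x - a) / 2"
    have d: "d > 0" using that by (simp add: d_def half_plane_def)
    obtain M where M: "\<And>n s. n \<ge> 1 \<Longrightarrow> norm s \<le> norm x + d \<Longrightarrow> norm (\<rho> n s) \<le> M / real n ^ q"
      using bnd by blast
    define e where "e = real A - real q - (Re x - d)"
    have e: "e < -1" using d by (simp add: e_def d_def a_def field_simps)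
    have "norm (?t n y) \<le> \<bar>C0\<bar> * \<bar>M\<bar> * real n powr e" if n: "n \<ge> 1" and y: "y \<in> ball x d" for n y
    proof -
      have "\<bar>Re (x - y)\<bar> \<le> norm (x - y)" by (rule abs_Re_le_cmod)
      hence re: "Re y \<ge> Re x - d" using y by (auto simp: dist_norm)
      have "norm y \<le> norm x + norm (y - x)"
        by (metis add_diff_cancel_left' diff_add_cancel norm_triangle_ineq)
      hence "norm y \<le> norm x + d" using y by (auto simp: dist_norm norm_minus_commute)
      from M[OF n this] have r: "norm (\<rho> n y) \<le> \<bar>M\<bar> / real n ^ q"
        by (rule order_trans) (auto intro!: divide_right_mono)
      have p: "norm (of_nat n powr (-y) :: complex) \<le> real n powr (-(Re x - d))"
        using n re norm_powr_real_powr[of "of_nat n" "-y"] by (auto intro!: powr_mono)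
      have "norm (?t n y) \<le> (\<bar>C0\<bar> * real n ^ A) * real n powr (-(Re x - d)) * (\<bar>M\<bar> / real n ^ q)"
        unfolding norm_mult by (intro mult_mono C n p r) auto
      also have "\<dots> = \<bar>C0\<bar> * \<bar>M\<bar> * real n powr e"
        using n by (simp add: e_def powr_diff powr_realpow powr_minus divide_simps)
      finally show ?thesis .
    qed
    hence "\<forall>\<^sub>F n in sequentially. \<forall>y\<in>ball x d \<inter> half_plane a. norm (?t n y) \<le> \<bar>C0\<bar> * \<bar>M\<bar> * real n powr e"
      by (intro eventually_sequentiallyI[of 1]) auto
    moreover have "summable (\<lambda>n. \<bar>C0\<bar> * \<bar>M\<bar> * real n powr e)"
      using e by (intro summable_mult) (simp add: summable_real_powr_iff)
    ultimately show ?thesis using d by blast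
  qed
  have "\<exists>g g'. \<forall>x \<in> half_plane a. ((\<lambda>n. ?t n x) sums g x) \<and>
      ((\<lambda>n. deriv (?t n) x) sums g' x) \<and> (g has_field_derivative g' x) (at x)"
    by (rule series_and_derivative_comparison_local[OF half_plane_open _ loc])
       (auto intro!: holomorphic_derivI[OF thol])
  then obtain g g' where g: "\<And>x. x \<in> half_plane a \<Longrightarrow> (\<lambda>n. ?t n x) sums g x"
    and g': "\<And>x. x \<in> half_plane a \<Longrightarrow> (g has_field_derivative g' x) (at x)" by blast
  show "summable (\<lambda>n. ?t n s)" if "Re s > a" for s
    using g[of s] that by (auto simp: half_plane_def sums_iff)
  have "g holomorphic_on half_plane a"
    using g' by (auto simp: holomorphic_on_open)
  thus "(\<lambda>s. \<Sum>n. ?t n s) holomorphic_on half_plane a"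
    by (rule holomorphic_transform) (use g in \<open>auto simp: sums_iff\<close>)
qed

lemma
  assumes "growth_bound A f"
  shows dirichlet_series_sums:
      "\<And>s. Re s > real A + 1 \<Longrightarrow> (\<lambda>n. f n * of_nat n powr (-s)) sums dirichlet_series f s"
    and dirichlet_series_holomorphic:
      "dirichlet_series f holomorphic_on half_plane (real A + 1)"
proof -
  have "\<exists>M. \<forall>n\<ge>1. \<forall>s. norm s \<le> R \<longrightarrow> norm (1::complex) \<le> M / real n ^ 0" for R
    by (rule exI[of _ 1]) auto
  note * = twisted_dirichlet_series[OF assms, of "\<lambda>_ _. 1" 0, OF _ this, simplified]
  show "\<And>s. Re s > real A + 1 \<Longrightarrow> (\<lambda>n. f n * of_nat n powr (-s)) sums dirichlet_series f s"
    unfolding dirichlet_series_def using *(1) by (auto simp: summable_sums)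
  show "dirichlet_series f holomorphic_on half_plane (real A + 1)"
    using *(2) by (simp add: dirichlet_series_def[abs_def])
qed

section \<open>Binomial expansion with a uniform remainder\<close>

definition binomial_remainder :: "nat \<Rightarrow> complex \<Rightarrow> complex \<Rightarrow> complex" where
  "binomial_remainder N x s = (1 + x) powr (-s) - (\<Sum>j\<le>N. ((-s) gchoose j) * x ^ j)"

lemma gbinomial_holomorphic [holomorphic_intros]:
  "g holomorphic_on A \<Longrightarrow> (\<lambda>s. (g s :: complex) gchoose j) holomorphic_on A"
  unfolding gbinomial_prod_rev by (intro holomorphic_intros) auto

lemma binomial_remainder_holomorphic:
  assumes "1 + x \<noteq> 0"
  shows "binomial_remainder N x holomorphic_on UNIV"
  unfolding binomial_remainder_def[abs_def] using assms by (intro holomorphic_intros)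

text \<open>Taylor's theorem along the segment from 0 to \<open>x\<close>, with \<open>s\<close> as
  a parameter. On it \<open>1 + z\<close> is a real number between 1 and 2, so the derivative of
  order \<open>N + 1\<close> is bounded uniformly for \<open>norm s \<le> R\<close>.\<close>

lemma binomial_remainder_bound:
  "\<exists>M. \<forall>x s. x \<in> {0..1} \<longrightarrow> norm s \<le> R \<longrightarrow>
     norm (binomial_remainder N (of_real x) s) \<le> M * x ^ Suc N"
proof (intro exI allI impI)
  fix x :: real and s :: complex
  assume x: "x \<in> {0..1}" and s: "norm s \<le> R"
  \<comment> \<open>\<open>f i\<close> is the \<open>i\<close>-th derivative of
    \<open>(1 + z) powr (-s)\<close>; its value at 0 divided by \<open>fact i\<close> is the
    binomial coefficient of \<open>-s\<close> over \<open>i\<close>.\<close>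
  define f where "f = (\<lambda>i z. (\<Prod>l<i. - s - of_nat l) * (1 + z) powr (- s - of_nat i))"
  let ?S = "closed_segment 0 (of_real x :: complex)"
  let ?B = "(R + real N) ^ Suc N * 2 powr R"
  have S: "\<exists>t\<in>{0..1}. z = of_real t" if "z \<in> ?S" for z
  proof -
    from that obtain u where u: "0 \<le> u" "u \<le> 1" "z = of_real (u * x)"
      by (auto simp: in_segment scaleR_conv_of_real)
    have "u * x \<in> {0..1}" using u x by (auto intro: mult_le_one)
    thus ?thesis using u by blast
  qed
  have "norm (f 0 (of_real x) - (\<Sum>i\<le>N. f i 0 * (of_real x - 0) ^ i / fact i))
      \<le> ?B * norm (of_real x - 0 :: complex) ^ Suc N / fact N"
  proof (rule complex_Taylor[of ?S])
    fix i z assume z: "z \<in> ?S"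
    obtain t where t: "t \<in> {0..1}" "z = of_real t" using S[OF z] by blast
    have "1 + z \<notin> \<real>\<^sub>\<le>\<^sub>0" using t by (auto simp: complex_nonpos_Reals_iff)
    then show "(f i has_field_derivative f (Suc i) z) (at z within ?S)"
      unfolding f_def
      by (auto intro!: derivative_eq_intros simp: algebra_simps)
  next
    fix z assume z: "z \<in> ?S"
    obtain t where t: "t \<in> {0..1}" "z = of_real t" using S[OF z] by blast
    have "norm (\<Prod>l<Suc N. - s - of_nat l) \<le> (\<Prod>l<Suc N. R + real N)"
      unfolding prod_norm[symmetric]
    proof (intro prod_mono conjI)
      fix l assume "l \<in> {..<Suc N}"
      have "norm (- s - of_nat l) \<le> norm (- s) + norm (of_nat l :: complex)"
        by (rule norm_triangle_ineq4)
      also have "\<dots> \<le> R + real N" using s \<open>l \<in> _\<close> by auto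
      finally show "norm (- s - of_nat l) \<le> R + real N" .
    qed auto
    moreover have "norm ((1 + z) powr (- s - of_nat (Suc N))) \<le> 2 powr R"
    proof -
      have "norm ((1 + z) powr (- s - of_nat (Suc N))) = (1 + t) powr (- Re s - real (Suc N))"
        using t norm_powr_real_powr[of "1 + z" "- s - of_nat (Suc N)"] by simp
      \<comment> \<open>The base is at least 1 and \<open>Re s \<ge> -R\<close>, so the exponent may
        be raised to \<open>R\<close>.\<close>
      also have "\<dots> \<le> (1 + t) powr R"
        using t s abs_Re_le_cmod[of s] by (intro powr_mono) auto
      also have "\<dots> \<le> 2 powr R"
        using t s by (intro powr_mono2) (auto intro: order_trans[OF norm_ge_zero s])
      finally show ?thesis .
    qed
    ultimately show "norm (f (Suc N) z) \<le> ?B"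
      unfolding f_def norm_mult
      by (intro mult_mono) (auto intro!: mult_nonneg_nonneg zero_le_power order_trans[OF norm_ge_zero s] add_nonneg_nonneg)
  qed auto
  also have "f 0 (of_real x) - (\<Sum>i\<le>N. f i 0 * (of_real x - 0) ^ i / fact i)
      = binomial_remainder N (of_real x) s"
    by (simp add: f_def binomial_remainder_def gbinomial_prod_rev lessThan_atLeast0)
  finally show "norm (binomial_remainder N (of_real x) s) \<le> (?B / fact N) * x ^ Suc N"
    using x by simp
qed

section \<open>The functional equation\<close>

definition decimate :: "nat \<Rightarrow> nat \<Rightarrow> (nat \<Rightarrow> complex) \<Rightarrow> nat \<Rightarrow> complex" where
  "decimate k r f n = f (k * n + r)"

text \<open>This is the operator \<open>T\<close> of the overview. It replaces a sequence by its
  sums over consecutive blocks of length \<open>k\<close>.\<close>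

definition residue_sum :: "nat \<Rightarrow> (nat \<Rightarrow> complex) \<Rightarrow> nat \<Rightarrow> complex" where
  "residue_sum k f n = (\<Sum>r<k. decimate k r f n)"

text \<open>For \<open>n \<ge> 1\<close> the index \<open>k * n + r\<close> is at most
  \<open>(k + r) * n\<close>, so only the constant changes and the exponent \<open>A\<close>
  survives.\<close>

lemma growth_bound_decimate:
  assumes "growth_bound A f" "k \<ge> 1"
  shows "growth_bound A (decimate k r f)"
proof -
  obtain C where C: "\<And>n. n \<ge> 1 \<Longrightarrow> norm (f n) \<le> C * real n ^ A"
    using assms(1) by (auto simp: growth_bound_def)
  have C0: "C \<ge> 0" using order_trans[OF norm_ge_zero C[of 1]] by simp
  have "norm (decimate k r f n) \<le> (C * (real k + real r) ^ A) * real n ^ A" if "n \<ge> 1" for n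
  proof -
    have le: "real (k * n + r) \<le> (real k + real r) * real n"
      using that mult_left_mono[of 1 "real n" "real r"] by (simp add: algebra_simps)
    have "norm (decimate k r f n) \<le> C * real (k * n + r) ^ A"
      unfolding decimate_def using that assms(2) by (intro C) (simp add: Suc_le_eq)
    also have "\<dots> \<le> C * ((real k + real r) * real n) ^ A"
      by (intro mult_left_mono power_mono C0 le) auto
    finally show ?thesis by (simp add: power_mult_distrib mult_ac)
  qed
  thus ?thesis unfolding growth_bound_def by blast
qed

lemma dirichlet_series_sum:
  assumes "\<And>i. i \<in> I \<Longrightarrow> growth_bound A (g i)" "Re s > real A + 1"
  shows "dirichlet_series (\<lambda>n. \<Sum>i\<in>I. c i * g i n) s = (\<Sum>i\<in>I. c i * dirichlet_series (g i) s)"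
proof -
  have "(\<lambda>n. \<Sum>i\<in>I. c i * (g i n * of_nat n powr (-s))) sums (\<Sum>i\<in>I. c i * dirichlet_series (g i) s)"
    using assms by (intro sums_sum sums_mult dirichlet_series_sums[where A = A])
  thus ?thesis
    unfolding dirichlet_series_def by (simp add: sums_iff sum_distrib_right mult.assoc)
qed

text \<open>Write \<open>k * n + r = (k * n) * (1 + r / (k * n))\<close>; the power splits over the
  product because the factors are nonnegative reals. Each \<open>n ^ -j\<close> from the Taylor
  polynomial becomes a shift of the exponent by \<open>j\<close>.\<close>

lemma powr_arith_progression_expand:
  fixes k n r N :: nat and s :: complex
  assumes "k \<ge> 1" "n \<ge> 1"
  shows "of_nat (k * n + r) powr (-s) = of_nat k powr (-s) *
     ((\<Sum>j\<le>N. ((-s) gchoose j) * (of_nat r / of_nat k) ^ j * of_nat n powr (-(s + of_nat j))) +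
      of_nat n powr (-s) * binomial_remainder N (of_nat r / (of_nat k * of_nat n)) s)"
proof -
  let ?x = "of_nat r / (of_nat k * of_nat n) :: complex"
  have x: "?x = of_real (real r / (real k * real n))" by simp
  have "(of_nat (k * n + r) :: complex) = (of_nat k * of_nat n) * (1 + ?x)"
    using assms by (simp add: field_simps)
  also have "\<dots> powr (-s) = (of_nat k * of_nat n) powr (-s) * (1 + ?x) powr (-s)"
    unfolding x by (intro powr_times_real) auto
  also have "(of_nat k * of_nat n :: complex) powr (-s) = of_nat k powr (-s) * of_nat n powr (-s)"
    by (intro powr_times_real) auto
  finally have "of_nat (k * n + r) powr (-s) =
      of_nat k powr (-s) * of_nat n powr (-s) * (1 + ?x) powr (-s)" .
  moreover have "(of_nat n :: complex) powr (-(s + of_nat j)) = of_nat n powr (-s) / of_nat n ^ j" for j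
    using assms by (simp add: powr_diff powr_nat)
  ultimately show ?thesis
    by (simp add: binomial_remainder_def algebra_simps sum_distrib_left power_divide power_mult_distrib)
qed

text \<open>The series is cut into blocks of length \<open>k\<close>, and every block with
  \<open>n \<ge> 1\<close> is expanded. The terms with \<open>j = 0\<close> add up to the series of
  \<open>residue_sum k f\<close>, and the remainders of order \<open>n ^ -(N + 1)\<close> make
  \<open>E\<close> holomorphic \<open>N + 1\<close> units to the left of the line
  \<open>Re s = A + 1\<close>.\<close>

lemma dirichlet_functional_equation:
  assumes f: "growth_bound A f" and k: "k \<ge> 2"
  shows "\<exists>E. E holomorphic_on half_plane (real A + 1 - real (Suc N)) \<and>
    (\<forall>s. Re s > real A + 1 \<longrightarrow> dirichlet_series f s =
       of_nat k powr (-s) * dirichlet_series (residue_sum k f) s + E s +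
       of_nat k powr (-s) * (\<Sum>r<k. \<Sum>j\<in>{1..N}. ((-s) gchoose j) * (of_nat r / of_nat k) ^ j *
           dirichlet_series (decimate k r f) (s + of_nat j)))"
proof -
  define \<rho> where "\<rho> = (\<lambda>r n. binomial_remainder N (of_nat r / (of_nat k * of_nat n)))"
  define R where "R = (\<lambda>r s. \<Sum>n. decimate k r f n * of_nat n powr (-s) * \<rho> r n s)"
  \<comment> \<open>\<open>E\<close> also takes in the block \<open>n = 0\<close>, a finite sum to
    which the expansion does not apply.\<close>
  define E where "E = (\<lambda>s. (\<Sum>r<k. f r * of_nat r powr (-s)) + of_nat k powr (-s) * (\<Sum>r<k. R r s))"
  have gb: "growth_bound A (decimate k r f)" for r
    using f k by (intro growth_bound_decimate) auto
  have \<rho>hol: "\<rho> r n holomorphic_on UNIV" for r n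
  proof -
    have "1 + of_nat r / (of_nat k * of_nat n) = (of_real (1 + real r / (real k * real n)) :: complex)"
      by simp
    also have "\<dots> \<noteq> 0"
      by (metis add_pos_nonneg divide_nonneg_nonneg mult_nonneg_nonneg of_nat_0_le_iff of_real_eq_0_iff
          order_less_irrefl zero_less_one)
    finally show ?thesis unfolding \<rho>_def by (rule binomial_remainder_holomorphic)
  qed
  have \<rho>bnd: "\<exists>M. \<forall>n\<ge>1. \<forall>s. norm s \<le> B \<longrightarrow> norm (\<rho> r n s) \<le> M / real n ^ Suc N" if "r < k" for r B
  proof -
    obtain M where M: "\<And>x s. x \<in> {0..1} \<Longrightarrow> norm s \<le> B \<Longrightarrow>
        norm (binomial_remainder N (of_real x) s) \<le> M * x ^ Suc N"
      using binomial_remainder_bound by blast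
    have "norm (\<rho> r n s) \<le> \<bar>M\<bar> / real n ^ Suc N" if n: "n \<ge> 1" and s: "norm s \<le> B" for n s
    proof -
      \<comment> \<open>By \<open>r < k\<close> this argument is at most \<open>1 / n\<close>, which
        puts it into the unit interval and yields the decay in \<open>n\<close>.\<close>
      let ?x = "real r / (real k * real n)"
      have "?x = real r / real k / real n" by simp
      also have "\<dots> \<le> 1 / real n"
        using \<open>r < k\<close> n by (intro divide_right_mono) auto
      finally have x1: "?x \<le> 1 / real n" .
      also have "1 / real n \<le> 1" using n by simp
      finally have x: "?x \<in> {0..1}" by simp
      have "norm (\<rho> r n s) \<le> M * ?x ^ Suc N"
        using M[OF x s] by (simp add: \<rho>_def)
      also have "\<dots> \<le> \<bar>M\<bar> * (1 / real n) ^ Suc N"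
        by (intro mult_mono power_mono x1) auto
      finally show ?thesis by (simp add: power_one_over)
    qed
    thus ?thesis by blast
  qed
  note tw = twisted_dirichlet_series[OF gb \<rho>hol \<rho>bnd]
  have "E holomorphic_on half_plane (real A + 1 - real (Suc N))"
    unfolding E_def R_def
  proof (intro holomorphic_on_add holomorphic_on_sum holomorphic_on_mult[of "\<lambda>s. of_nat k powr (-s)"])
    show "(\<lambda>s. of_nat k powr (-s) :: complex) holomorphic_on half_plane (real A + 1 - real (Suc N))"
      using k by (intro holomorphic_intros) auto
    show "(\<lambda>s. f r * of_nat r powr (-s)) holomorphic_on half_plane (real A + 1 - real (Suc N))" for r
      by (cases "r = 0") (auto intro!: holomorphic_intros)
    show "(\<lambda>s. \<Sum>n. decimate k r f n * of_nat n powr (-s) * \<rho> r n s) holomorphic_on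
        half_plane (real A + 1 - real (Suc N))" if "r \<in> {..<k}" for r
      by (rule tw(2)) (use that in auto)
  qed
  moreover have "dirichlet_series f s =
       of_nat k powr (-s) * dirichlet_series (residue_sum k f) s + E s +
       of_nat k powr (-s) * (\<Sum>r<k. \<Sum>j\<in>{1..N}. ((-s) gchoose j) * (of_nat r / of_nat k) ^ j *
           dirichlet_series (decimate k r f) (s + of_nat j))" if s: "Re s > real A + 1" for s
  proof -
    let ?D = "\<lambda>r j. dirichlet_series (decimate k r f) (s + of_nat j)"
    let ?c = "\<lambda>r j. ((-s) gchoose j) * (of_nat r / of_nat k) ^ j"
    let ?e = "\<Sum>r<k. f r * of_nat r powr (-s)"
    let ?a = "\<lambda>n. f n * of_nat n powr (-s)"
    have grp: "(\<lambda>n. sum ?a {n * k ..< n * k + k}) sums dirichlet_series f s"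
      using k by (intro sums_group dirichlet_series_sums[OF f s]) auto
    \<comment> \<open>At \<open>n = 0\<close> the second summand vanishes because
      \<open>0 powr z = 0\<close>, so the conditional term is the whole block.\<close>
    have blk: "sum ?a {n * k ..< n * k + k} = (if n = 0 then ?e else 0) +
       of_nat k powr (-s) * (\<Sum>r<k. (\<Sum>j\<le>N. ?c r j * (decimate k r f n * of_nat n powr (-(s + of_nat j)))) +
          decimate k r f n * of_nat n powr (-s) * \<rho> r n s)" for n
    proof (cases "n = 0")
      case True
      then show ?thesis by (simp add: lessThan_atLeast0)
    next
      case False
      have "sum ?a {n * k ..< n * k + k} = (\<Sum>r<k. ?a (k * n + r))"
        using sum.shift_bounds_nat_ivl[of ?a 0 "n * k" k]
        by (simp add: lessThan_atLeast0 add_ac mult_ac)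
      also have "\<dots> = (\<Sum>r<k. of_nat k powr (-s) * ((\<Sum>j\<le>N. ?c r j * (decimate k r f n * of_nat n powr (-(s + of_nat j)))) +
          decimate k r f n * of_nat n powr (-s) * \<rho> r n s))"
      proof (rule sum.cong[OF refl])
        fix r
        show "?a (k * n + r) = of_nat k powr (-s) * ((\<Sum>j\<le>N. ?c r j * (decimate k r f n * of_nat n powr (-(s + of_nat j)))) +
          decimate k r f n * of_nat n powr (-s) * \<rho> r n s)"
          using False k
          by (subst powr_arith_progression_expand[where N = N])
             (auto simp: decimate_def \<rho>_def algebra_simps sum_distrib_left)
      qed
      finally show ?thesis using False by (simp add: sum_distrib_left)
    qed
    have 1: "(\<lambda>n. (if n = 0 then ?e else 0) +
       of_nat k powr (-s) * (\<Sum>r<k. (\<Sum>j\<le>N. ?c r j * (decimate k r f n * of_nat n powr (-(s + of_nat j)))) +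
          decimate k r f n * of_nat n powr (-s) * \<rho> r n s)) sums dirichlet_series f s"
      using grp unfolding blk .
    have "(\<lambda>n. (if n = 0 then ?e else 0) +
       of_nat k powr (-s) * (\<Sum>r<k. (\<Sum>j\<le>N. ?c r j * (decimate k r f n * of_nat n powr (-(s + of_nat j)))) +
          decimate k r f n * of_nat n powr (-s) * \<rho> r n s)) sums
       (?e + of_nat k powr (-s) * (\<Sum>r<k. (\<Sum>j\<le>N. ?c r j * ?D r j) + R r s))"
    proof (intro sums_add sums_mult sums_sum)
      show "(\<lambda>n. if n = 0 then ?e else 0) sums ?e"
        using sums_single[of 0 "\<lambda>_. ?e"] by simp
      show "(\<lambda>n. decimate k r f n * of_nat n powr (-(s + of_nat j))) sums ?D r j" for r j
        using s by (intro dirichlet_series_sums[OF gb]) auto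
      show "(\<lambda>n. decimate k r f n * of_nat n powr (-s) * \<rho> r n s) sums R r s" if "r \<in> {..<k}" for r
        unfolding R_def by (intro summable_sums tw(1)) (use that s in auto)
    qed
    from sums_unique2[OF 1 this]
    have "dirichlet_series f s =
        ?e + of_nat k powr (-s) * (\<Sum>r<k. (\<Sum>j\<le>N. ?c r j * ?D r j) + R r s)" .
    moreover have "(\<Sum>j\<le>N. ?c r j * ?D r j) = ?D r 0 + (\<Sum>j\<in>{1..N}. ?c r j * ?D r j)" for r
    proof -
      have "{..N} = insert 0 {1..N}" by auto
      thus ?thesis by simp
    qed
    moreover have "(\<Sum>r<k. ?D r 0) = dirichlet_series (residue_sum k f) s"
      using dirichlet_series_sum[of "{..<k}" A "\<lambda>r. decimate k r f" s "\<lambda>_. 1"] gb s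
      by (simp add: residue_sum_def[abs_def])
    ultimately show ?thesis
      by (simp add: E_def sum.distrib algebra_simps)
  qed
  ultimately show ?thesis by blast
qed

section \<open>Meromorphic continuation from a right half-plane\<close>

text \<open>
  The bound \<open>a\<close> may lie to the right of \<open>U\<close>'s boundary, which makes the zeros of
  \<open>1 - z k\<^sup>-\<^sup>s\<close> harmless when dividing by that factor.
\<close>
definition continuable :: "complex set \<Rightarrow> complex set \<Rightarrow> (complex \<Rightarrow> complex) \<Rightarrow> bool" where
  "continuable U P h \<longleftrightarrow> (\<exists>g a. g meromorphic_on U \<and> g analytic_on (U - P) \<and>
     (\<forall>s. Re s > a \<longrightarrow> g s = h s))"

lemma continuable_analytic:
  assumes "h analytic_on U"
  shows "continuable U P h"
  unfolding continuable_def
  using assms analytic_on_subset[OF assms, of "U - P"] analytic_on_imp_meromorphic_on by blast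

lemma continuable_holomorphic:
  assumes "h holomorphic_on U" "open U"
  shows "continuable U P h"
  using assms by (intro continuable_analytic) (simp add: analytic_on_open)

lemma continuable_cong:
  assumes "continuable U P h" "\<And>s. Re s > b \<Longrightarrow> h' s = h s"
  shows "continuable U P h'"
proof -
  from assms(1) obtain g a where g: "g meromorphic_on U" "g analytic_on (U - P)" "\<And>s. Re s > a \<Longrightarrow> g s = h s"
    unfolding continuable_def by blast
  show ?thesis unfolding continuable_def
    by (rule exI[of _ g], rule exI[of _ "max a b"]) (use g assms(2) in auto)
qed

lemma continuable_add:
  assumes "continuable U P h1" "continuable U P h2"
  shows "continuable U P (\<lambda>s. h1 s + h2 s)"
proof -
  from assms obtain g a g' a' where g: "g meromorphic_on U" "g analytic_on (U - P)" "\<And>s. Re s > a \<Longrightarrow> g s = h1 s"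
    and g': "g' meromorphic_on U" "g' analytic_on (U - P)" "\<And>s. Re s > a' \<Longrightarrow> g' s = h2 s"
    unfolding continuable_def by blast
  show ?thesis unfolding continuable_def
    by (rule exI[of _ "\<lambda>s. g s + g' s"], rule exI[of _ "max a a'"])
       (use g g' in \<open>auto intro!: meromorphic_intros analytic_intros\<close>)
qed

lemma continuable_mult:
  assumes "continuable U P h1" "continuable U P h2"
  shows "continuable U P (\<lambda>s. h1 s * h2 s)"
proof -
  from assms obtain g a g' a' where g: "g meromorphic_on U" "g analytic_on (U - P)" "\<And>s. Re s > a \<Longrightarrow> g s = h1 s"
    and g': "g' meromorphic_on U" "g' analytic_on (U - P)" "\<And>s. Re s > a' \<Longrightarrow> g' s = h2 s"
    unfolding continuable_def by blast
  show ?thesis unfolding continuable_def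
    by (rule exI[of _ "\<lambda>s. g s * g' s"], rule exI[of _ "max a a'"])
       (use g g' in \<open>auto intro!: meromorphic_intros analytic_intros\<close>)
qed

lemma continuable_sum:
  assumes "\<And>i. i \<in> I \<Longrightarrow> continuable U P (h i)"
  shows "continuable U P (\<lambda>s. \<Sum>i\<in>I. h i s)"
  using assms
proof (induction I rule: infinite_finite_induct)
  case (insert x F)
  have "continuable U P (\<lambda>s. h x s + (\<Sum>i\<in>F. h i s))"
    by (intro continuable_add insert.IH insert.prems) auto
  thus ?case using insert.hyps by simp
qed (auto intro!: continuable_analytic)

text \<open>Division can create poles only at zeros of \<open>q\<close>, and those in
  \<open>U\<close> lie in \<open>P\<close>.\<close>

lemma continuable_divide:
  assumes "continuable U P h" and q: "q analytic_on U" "\<And>s. s \<in> U - P \<Longrightarrow> q s \<noteq> 0"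
  shows "continuable U P (\<lambda>s. h s / q s)"
proof -
  from assms obtain g a where g: "g meromorphic_on U" "g analytic_on (U - P)" "\<And>s. Re s > a \<Longrightarrow> g s = h s"
    unfolding continuable_def by blast
  have "(\<lambda>s. g s / q s) analytic_on (U - P)"
    using q by (intro analytic_intros g analytic_on_subset[OF q(1)]) auto
  moreover have "(\<lambda>s. g s / q s) meromorphic_on U"
    by (intro meromorphic_intros g analytic_on_imp_meromorphic_on[OF q(1)])
  ultimately show ?thesis unfolding continuable_def using g(3) by (metis (mono_tags, lifting))
qed

text \<open>Poles move left by \<open>j\<close>, and the last hypothesis lets \<open>P\<close>
  absorb such moves. The region \<open>U'\<close> may reach \<open>j\<close> units further left than
  \<open>U\<close>.\<close>

lemma continuable_shift:
  assumes "continuable U P h"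
    and "\<And>s. s \<in> U' \<Longrightarrow> s + of_nat j \<in> U" "\<And>s. s + of_nat j \<in> P \<Longrightarrow> s \<in> P"
  shows "continuable U' P (\<lambda>s. h (s + of_nat j))"
proof -
  from assms obtain g a where g: "g meromorphic_on U" "g analytic_on (U - P)" "\<And>s. Re s > a \<Longrightarrow> g s = h s"
    unfolding continuable_def by blast
  have sh: "(\<lambda>s. s + of_nat j) analytic_on X" for X :: "complex set"
    by (intro analytic_intros)
  have "(\<lambda>s. g (s + of_nat j)) meromorphic_on U'"
    by (rule meromorphic_on_compose[OF g(1) sh]) (use assms in auto)
  moreover have "(g \<circ> (\<lambda>s. s + of_nat j)) analytic_on (U' - P)"
    by (rule analytic_on_compose_gen[OF sh g(2)]) (use assms in auto)
  moreover have "g (s + of_nat j) = h (s + of_nat j)" if "Re s > a" for s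
    using that by (intro g) auto
  ultimately show ?thesis unfolding continuable_def o_def by blast
qed

text \<open>Identity theorem for meromorphic functions: the difference vanishes on a nonempty open
  set, so it cannot avoid 0 and is 0 off a sparse set. Values at isolated points may still differ,
  hence \<open>remove_sings\<close>.\<close>

lemma remove_sings_eq_of_eq_on_open:
  assumes g: "g meromorphic_on A" "g' meromorphic_on A" and A: "open A" "connected A"
    and U: "open U" "U \<noteq> {}" "U \<subseteq> A" "\<And>z. z \<in> U \<Longrightarrow> g z = g' z" and z: "z \<in> A"
  shows "remove_sings g z = remove_sings g' z"
proof -
  have "(\<lambda>s. g s - g' s) meromorphic_on A"
    by (intro meromorphic_intros g)
  from meromorphic_imp_constant_or_avoid[OF this A, of 0]
  have "\<forall>\<^sub>\<approx>s\<in>A. g s - g' s = 0"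
  proof
    assume ev: "\<forall>\<^sub>\<approx>s\<in>A. g s - g' s \<noteq> 0"
    obtain u where u: "u \<in> U" using U by blast
    have "\<forall>\<^sub>F s in at u. g s - g' s \<noteq> 0"
      using ev u U A by (auto simp: eventually_cosparse_open_eq)
    moreover have "\<forall>\<^sub>F s in at u. s \<in> U"
      using u U by (intro eventually_at_in_open') auto
    ultimately have "\<forall>\<^sub>F s in at u. False"
      by eventually_elim (use U in auto)
    thus ?thesis by simp
  qed
  hence "\<forall>\<^sub>F s in at z. g s = g' s"
    using z A by (auto simp: eventually_cosparse_open_eq)
  thus ?thesis by (intro remove_sings_cong) auto
qed

text \<open>The continuations agree on overlaps once removable singularities are filled in, so they
  glue to one function on the plane. Holomorphy of \<open>h\<close> ensures that the filling leaves
  the values far to the right unchanged.\<close>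

lemma continuable_half_planes_imp_nicely_meromorphic:
  assumes cont: "\<And>N. continuable (half_plane (b - real N)) P h"
    and h: "h holomorphic_on half_plane b"
  shows "\<exists>G a. G nicely_meromorphic_on UNIV \<and> (\<forall>z. is_pole G z \<longrightarrow> z \<in> P) \<and>
     (\<forall>s. Re s > a \<longrightarrow> G s = h s)"
proof -
  obtain g a where g: "\<And>N. g N meromorphic_on half_plane (b - real N)"
    "\<And>N. g N analytic_on half_plane (b - real N) - P" "\<And>N s. Re s > a N \<Longrightarrow> g N s = h s"
    using cont unfolding continuable_def by metis
  have eq: "remove_sings (g M) z = remove_sings (g N) z"
    if z: "z \<in> half_plane (b - real M)" "z \<in> half_plane (b - real N)" for M N z
  proof -
    have *: "remove_sings (g M) z = remove_sings (g N) z"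
      if "M \<le> N" and z: "z \<in> half_plane (b - real M)" for M N
    proof (rule remove_sings_eq_of_eq_on_open[where U = "half_plane (max b (max (a M) (a N)))"])
      show "g N meromorphic_on half_plane (b - real M)"
        by (rule meromorphic_on_subset[OF g(1)]) (use \<open>M \<le> N\<close> in \<open>auto simp: half_plane_def\<close>)
      show "half_plane (max b (max (a M) (a N))) \<noteq> {}"
        unfolding half_plane_def
        by (rule ex_in_conv[THEN iffD1], rule exI[of _ "of_real (max b (max (a M) (a N)) + 1)"]) auto
      show "half_plane (max b (max (a M) (a N))) \<subseteq> half_plane (b - real M)"
        by (auto simp: half_plane_def)
      show "g M z = g N z" if "z \<in> half_plane (max b (max (a M) (a N)))" for z
        using that g(3) by (auto simp: half_plane_def)
    qed (use g(1) z in simp_all)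
    show ?thesis using *[OF _ z(1), of N] *[OF _ z(2), of M] by (metis nat_le_linear)
  qed
  define n where "n = (\<lambda>s. nat \<lceil>b - Re s + 1\<rceil>)"
  have n: "s \<in> half_plane (b - real (n s))" for s
    unfolding half_plane_def n_def by simp linarith
  define G where "G = (\<lambda>s. remove_sings (g (n s)) s)"
  have G: "G s = remove_sings (g N) s" if "s \<in> half_plane (b - real N)" for s N
    unfolding G_def by (rule eq[OF n that])
  have ev: "\<forall>\<^sub>F w in nhds z. G w = remove_sings (g (n z)) w" for z
    using eventually_nhds_in_open[OF half_plane_open n[of z]]
    by eventually_elim (rule G)
  have ev': "\<forall>\<^sub>F w in at z. G w = remove_sings (g (n z)) w" for z
    using ev[of z] by (auto simp: eventually_at_filter elim: eventually_mono)
  have nice: "remove_sings (g N) nicely_meromorphic_on half_plane (b - real N)" for N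
    by (rule remove_sings_nicely_meromorphic[OF g(1)])
  have pole: "is_pole G z \<longleftrightarrow> is_pole (remove_sings (g (n z))) z" for z
    by (rule is_pole_cong[OF ev' refl])
  have "G nicely_meromorphic_on UNIV"
    unfolding nicely_meromorphic_on_def
  proof (intro conjI ballI)
    have "G meromorphic_on {z}" for z
    proof -
      have "remove_sings (g (n z)) meromorphic_on {z}"
        using nice[of "n z"] n[of z] by (auto simp: nicely_meromorphic_on_def intro: meromorphic_on_subset)
      thus ?thesis
        by (subst meromorphic_on_cong[OF _ refl]) (use ev' in auto)
    qed
    thus "G meromorphic_on UNIV" by (subst meromorphic_on_meromorphic_at) auto
    fix z
    have "(is_pole (remove_sings (g (n z))) z \<and> remove_sings (g (n z)) z = 0) \<or>
        remove_sings (g (n z)) \<midarrow>z\<rightarrow> remove_sings (g (n z)) z"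
      using nice[of "n z"] n[of z] by (auto simp: nicely_meromorphic_on_def)
    moreover have "(G \<midarrow>z\<rightarrow> G z) \<longleftrightarrow> remove_sings (g (n z)) \<midarrow>z\<rightarrow> G z"
      by (rule tendsto_cong[OF ev'])
    ultimately show "(is_pole G z \<and> G z = 0) \<or> G \<midarrow>z\<rightarrow> G z"
      unfolding pole by (simp add: G_def)
  qed
  moreover have "z \<in> P" if "is_pole G z" for z
  proof (rule ccontr)
    assume "z \<notin> P"
    hence "g (n z) analytic_on {z}"
      using n[of z] by (intro analytic_on_subset[OF g(2)]) auto
    hence "remove_sings (g (n z)) analytic_on {z}"
      by (rule remove_sings_analytic_on)
    thus False using that pole analytic_at_imp_no_pole by blast
  qed
  moreover have "G s = h s" if "Re s > max b (a 0)" for s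
  proof -
    let ?U = "half_plane (max b (a 0))"
    have s: "s \<in> ?U" using that by (simp add: half_plane_def)
    have U: "g 0 w = h w" if "w \<in> ?U" for w
      using that by (intro g) (auto simp: half_plane_def)
    have "h holomorphic_on ?U"
      by (rule holomorphic_on_subset[OF h]) (auto simp: half_plane_def)
    hence "g 0 holomorphic_on ?U"
      by (rule holomorphic_transform) (simp add: U)
    hence "g 0 analytic_on {s}"
      using s unfolding analytic_at by (intro exI[of _ ?U]) auto
    hence "remove_sings (g 0) s = h s" using U[OF s] by simp
    moreover have "s \<in> half_plane (b - real 0)" using that by (simp add: half_plane_def)
    ultimately show ?thesis using G[of s 0] by simp
  qed
  ultimately show ?thesis by blast
qed

section \<open>The space spanned by the kernel\<close>

text \<open>The scalars are complex although the kernel lies in an integer span: the dimension count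
  needs a field, and the splitting of annihilating polynomials an algebraically closed one.\<close>

interpretation seq: vector_space "\<lambda>(c::complex) (f :: nat \<Rightarrow> complex) n. c * f n"
  by unfold_locales (auto simp: fun_eq_iff algebra_simps)

lemma int_span_subset_span:
  assumes "finite B"
  shows "int_span B \<subseteq> seq.span B"
proof
  fix f assume "f \<in> int_span B"
  then obtain c :: "(nat \<Rightarrow> complex) \<Rightarrow> int" where c: "f = (\<lambda>n. \<Sum>b\<in>B. of_int (c b) * b n)"
    by (auto simp: int_span_def)
  have "f = (\<Sum>b\<in>B. (\<lambda>n. of_int (c b) * b n))"
    unfolding c by (rule ext, induction B rule: infinite_finite_induct) auto
  also have "\<dots> \<in> seq.span B"
    by (intro seq.span_sum seq.span_scale seq.span_base)
  finally show "f \<in> seq.span B" .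
qed

text \<open>Substituting \<open>k * n + r\<close> at level \<open>l\<close> with residue
  \<open>t\<close> gives level \<open>l + 1\<close> with residue
  \<open>k ^ l * r + t\<close>.\<close>

lemma decimate_kernel:
  assumes "f \<in> k_kernel k v" "r < k"
  shows "decimate k r f \<in> k_kernel k v"
proof -
  from assms obtain l t where f: "f = (\<lambda>n. v (k ^ l * n + t))" and t: "t < k ^ l"
    by (auto simp: k_kernel_def)
  have "decimate k r f = (\<lambda>n. v (k ^ Suc l * n + (k ^ l * r + t)))"
    by (simp add: decimate_def f fun_eq_iff algebra_simps)
  moreover have "k ^ l * r + t < k ^ Suc l"
  proof -
    have "k ^ l * r + t < k ^ l * (r + 1)" using t by simp
    also have "\<dots> \<le> k ^ l * k" using assms(2) by (intro mult_le_mono2) simp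
    finally show ?thesis by (simp add: mult.commute)
  qed
  ultimately show ?thesis unfolding k_kernel_def by blast
qed

lemma decimate_span:
  assumes "\<And>b. b \<in> K \<Longrightarrow> decimate k r b \<in> seq.span K" "f \<in> seq.span K"
  shows "decimate k r f \<in> seq.span K"
  using assms(2)
proof (induction rule: seq.span_induct_alt)
  case base
  have "decimate k r 0 = 0" by (simp add: decimate_def fun_eq_iff)
  thus ?case by (simp only: seq.span_zero)
next
  case (step c x y)
  have "decimate k r ((\<lambda>n. c * x n) + y) = (\<lambda>n. c * decimate k r x n) + decimate k r y"
    by (simp add: decimate_def fun_eq_iff)
  moreover have "\<dots> \<in> seq.span K"
    using step assms(1) by (intro seq.span_add seq.span_scale) auto
  ultimately show ?case by (simp only:)
qed

text \<open>\<open>K\<close> is a maximal independent part of the kernel itself, whose span inherits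
  stability under decimation; the span of \<open>B\<close> need not be stable. \<open>B\<close> only
  bounds the size of \<open>K\<close>.\<close>

lemma regular_kernel_finite_basis:
  assumes "k_regular k v"
  obtains K where "finite K" "v \<in> seq.span K" "\<And>f r. r < k \<Longrightarrow> f \<in> seq.span K \<Longrightarrow> decimate k r f \<in> seq.span K"
proof -
  obtain B where B: "finite B" "k_kernel k v \<subseteq> int_span B"
    using assms by (auto simp: k_regular_def)
  obtain K where K: "K \<subseteq> k_kernel k v" "seq.independent K" "k_kernel k v \<subseteq> seq.span K"
    by (rule seq.maximal_independent_subset)
  have "finite K"
    using seq.independent_span_bound[OF B(1) K(2)] K(1) B int_span_subset_span[OF B(1)] by blast
  moreover have "v \<in> k_kernel k v"
    unfolding k_kernel_def by (rule CollectI, rule exI[of _ 0], rule exI[of _ 0]) auto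
  moreover have "decimate k r f \<in> seq.span K" if "r < k" "f \<in> seq.span K" for f r
  proof (rule decimate_span)
    show "decimate k r b \<in> seq.span K" if "b \<in> K" for b
      using decimate_kernel[of b k v r] that K(1,3) \<open>r < k\<close> by (meson subsetD)
  qed fact
  ultimately show ?thesis by (intro that[of K]) (use K(3) in \<open>auto simp: subset_iff\<close>)
qed

section \<open>Polynomial growth on a space stable under decimation\<close>

lemma span_imp_linear_combination:
  assumes "finite K" "f \<in> seq.span K"
  shows "\<exists>c. f = (\<lambda>n. \<Sum>b\<in>K. c b * b n)"
proof -
  obtain c where "f = (\<Sum>b\<in>K. (\<lambda>n. c b * b n))"
    using assms by (auto simp: seq.span_finite)
  moreover have "(\<Sum>b\<in>K. (\<lambda>n. c b * b n)) = (\<lambda>n. \<Sum>b\<in>K. c b * b n)"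
    by (rule ext, use assms(1) in \<open>induction K rule: finite_induct\<close>) auto
  ultimately show ?thesis by blast
qed

lemma growth_bound_linear_combination:
  assumes "\<And>b. b \<in> K \<Longrightarrow> growth_bound A b"
  shows "growth_bound A (\<lambda>n. \<Sum>b\<in>K. c b * b n)"
proof -
  obtain C where C: "\<And>b n. b \<in> K \<Longrightarrow> n \<ge> 1 \<Longrightarrow> norm (b n) \<le> C b * real n ^ A"
    using assms unfolding growth_bound_def by metis
  have "norm (\<Sum>b\<in>K. c b * b n) \<le> (\<Sum>b\<in>K. norm (c b) * C b) * real n ^ A" if "n \<ge> 1" for n
  proof -
    have "norm (\<Sum>b\<in>K. c b * b n) \<le> (\<Sum>b\<in>K. norm (c b) * (C b * real n ^ A))"
      by (intro sum_norm_le) (auto simp: norm_mult intro!: mult_left_mono C that)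
    thus ?thesis by (simp add: sum_distrib_right mult.assoc)
  qed
  thus ?thesis unfolding growth_bound_def by blast
qed

text \<open>The total size \<open>m\<close> of the basis values at \<open>n\<close> grows by at most
  a factor \<open>C\<close> for each base-\<open>k\<close> digit appended to \<open>n\<close>. The
  number of digits is logarithmic in \<open>n\<close>, so \<open>m\<close> grows
  polynomially.\<close>

lemma decimation_closed_growth:
  assumes k: "k \<ge> 2" and K: "finite K"
    and closed: "\<And>f r. r < k \<Longrightarrow> f \<in> seq.span K \<Longrightarrow> decimate k r f \<in> seq.span K"
  shows "\<exists>A. \<forall>f\<in>seq.span K. growth_bound A f"
proof -
  have "\<exists>c. decimate k r b = (\<lambda>n. \<Sum>b'\<in>K. c b' * b' n)" if "r < k" "b \<in> K" for r b
    using that by (intro span_imp_linear_combination K closed seq.span_base)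
  then obtain c where c: "\<And>r b. r < k \<Longrightarrow> b \<in> K \<Longrightarrow> decimate k r b = (\<lambda>n. \<Sum>b'\<in>K. c r b b' * b' n)"
    by metis
  define m where "m = (\<lambda>n. \<Sum>b\<in>K. norm (b n))"
  define C where "C = 1 + (\<Sum>r<k. \<Sum>b\<in>K. \<Sum>b'\<in>K. norm (c r b b'))"
  have m0: "m n \<ge> 0" for n unfolding m_def by (intro sum_nonneg) auto
  have rec: "m (k * n + r) \<le> C * m n" if r: "r < k" for n r
  proof -
    have "m (k * n + r) = (\<Sum>b\<in>K. norm (decimate k r b n))"
      by (simp add: m_def decimate_def)
    also have "\<dots> \<le> (\<Sum>b\<in>K. (\<Sum>b'\<in>K. norm (c r b b')) * m n)"
    proof (rule sum_mono)
      fix b assume b: "b \<in> K"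
      have "norm (decimate k r b n) \<le> (\<Sum>b'\<in>K. norm (c r b b') * m n)"
        unfolding c[OF r b] norm_mult
      proof (intro sum_norm_le)
        fix b' assume "b' \<in> K"
        hence "norm (b' n) \<le> m n"
          unfolding m_def using K by (intro member_le_sum) auto
        thus "norm (c r b b' * b' n) \<le> norm (c r b b') * m n"
          by (simp add: norm_mult mult_left_mono)
      qed
      thus "norm (decimate k r b n) \<le> (\<Sum>b'\<in>K. norm (c r b b')) * m n"
        by (simp add: sum_distrib_right)
    qed
    also have "\<dots> = (\<Sum>b\<in>K. \<Sum>b'\<in>K. norm (c r b b')) * m n"
      by (simp add: sum_distrib_right)
    also have "\<dots> \<le> C * m n"
    proof (intro mult_right_mono m0)
      have "(\<Sum>b\<in>K. \<Sum>b'\<in>K. norm (c r b b')) \<le> (\<Sum>r<k. \<Sum>b\<in>K. \<Sum>b'\<in>K. norm (c r b b'))"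
        using r by (intro member_le_sum[of r "{..<k}" "\<lambda>r. \<Sum>b\<in>K. \<Sum>b'\<in>K. norm (c r b b')"])
          (auto intro!: sum_nonneg)
      thus "(\<Sum>b\<in>K. \<Sum>b'\<in>K. norm (c r b b')) \<le> C" by (simp add: C_def)
    qed
    finally show ?thesis .
  qed
  \<comment> \<open>The base 3/2 fits the recursion: \<open>n \<ge> 2 * q\<close> and
    \<open>q \<ge> 1\<close> give \<open>n + 1 \<ge> (3/2) * (q + 1)\<close>, so the factor
    \<open>C\<close> is paid for by \<open>(3/2) ^ A\<close>.\<close>
  obtain A where A: "C < (3/2) ^ A"
    using real_arch_pow[of "3/2" C] by auto
  \<comment> \<open>This constant settles the indices below \<open>k\<close>, where the induction
    starts.\<close>
  define M where "M = (\<Sum>n<k. m n)"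
  have M0: "M \<ge> 0" unfolding M_def by (intro sum_nonneg m0)
  have bnd: "m n \<le> M * real (n + 1) ^ A" for n
  proof (induction n rule: less_induct)
    case (less n)
    show ?case
    proof (cases "n < k")
      case True
      have "m n \<le> M" unfolding M_def using True m0 by (intro member_le_sum) auto
      also have "M * 1 \<le> M * real (n + 1) ^ A"
        by (intro mult_left_mono M0 one_le_power) auto
      finally show ?thesis by simp
    next
      case False
      define q r where "q = n div k" and "r = n mod k"
      have n: "n = k * q + r" and r: "r < k" using k by (auto simp: q_def r_def)
      have q: "q \<ge> 1" using False k by (simp add: q_def div_greater_zero_iff Suc_le_eq)
      have "q < n" unfolding q_def using k False by (intro div_less_dividend) auto
      have "2 * q \<le> k * q" using k by simp
      hence "2 * q \<le> n" using n by linarith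
      hence "2 * real q \<le> real n" by linarith
      hence le: "(3/2) * real (q + 1) \<le> real (n + 1)" using q by simp
      have "m n \<le> C * m q" unfolding n by (rule rec[OF r])
      also have "\<dots> \<le> (3/2) ^ A * (M * real (q + 1) ^ A)"
        using A by (intro mult_mono less.IH \<open>q < n\<close> m0) auto
      also have "\<dots> = M * ((3/2) * real (q + 1)) ^ A"
        by (simp only: power_mult_distrib mult_ac)
      also have "\<dots> \<le> M * real (n + 1) ^ A"
        by (intro mult_left_mono power_mono le M0) auto
      finally show ?thesis .
    qed
  qed
  have gbK: "growth_bound A b" if "b \<in> K" for b
    unfolding growth_bound_def
  proof (intro exI allI impI)
    fix n :: nat assume n: "n \<ge> 1"
    have "norm (b n) \<le> m n" unfolding m_def using K that by (intro member_le_sum) auto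
    also have "\<dots> \<le> M * real (n + 1) ^ A" by (rule bnd)
    also have "M * real (n + 1) ^ A \<le> M * (2 * real n) ^ A"
      using n by (intro mult_left_mono power_mono M0) auto
    finally show "norm (b n) \<le> (M * 2 ^ A) * real n ^ A"
      by (simp add: power_mult_distrib mult_ac)
  qed
  have "growth_bound A f" if "f \<in> seq.span K" for f
  proof -
    obtain c where f: "f = (\<lambda>n. \<Sum>b\<in>K. c b * b n)"
      using span_imp_linear_combination[OF K \<open>f \<in> seq.span K\<close>] by blast
    show ?thesis unfolding f by (rule growth_bound_linear_combination[OF gbK])
  qed
  thus ?thesis by blast
qed

section \<open>Annihilating polynomials of the residue sum operator\<close>

lemma residue_sum_funpow_linear:
  "(residue_sum k ^^ i) (\<lambda>n. f n - z * g n) = (\<lambda>n. (residue_sum k ^^ i) f n - z * (residue_sum k ^^ i) g n)"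
proof (induction i)
  case (Suc i)
  have "residue_sum k (\<lambda>n. F n - z * G n) = (\<lambda>n. residue_sum k F n - z * residue_sum k G n)" for F G
    by (simp add: residue_sum_def fun_eq_iff decimate_def sum_subtractf sum_distrib_left)
  thus ?case by (simp add: Suc)
qed auto

lemma residue_sum_span:
  assumes "\<And>f r. r < k \<Longrightarrow> f \<in> seq.span K \<Longrightarrow> decimate k r f \<in> seq.span K" "f \<in> seq.span K"
  shows "residue_sum k f \<in> seq.span K"
proof -
  have "residue_sum k f = (\<Sum>r\<in>{..<k}. decimate k r f)"
  proof
    fix n
    have "(\<Sum>r\<in>I. decimate k r f n) = (\<Sum>r\<in>I. decimate k r f) n" for I
      by (induction I rule: infinite_finite_induct) auto
    thus "residue_sum k f n = (\<Sum>r\<in>{..<k}. decimate k r f) n"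
      by (simp add: residue_sum_def)
  qed
  thus ?thesis using assms by (auto intro!: seq.span_sum)
qed

text \<open>This is \<open>p(T) f = 0\<close> for \<open>T = residue_sum k\<close>, written out
  pointwise.\<close>

definition annihilates :: "nat \<Rightarrow> complex poly \<Rightarrow> (nat \<Rightarrow> complex) \<Rightarrow> bool" where
  "annihilates k p f \<longleftrightarrow> (\<forall>n. (\<Sum>i\<le>degree p. coeff p i * (residue_sum k ^^ i) f n) = 0)"

text \<open>From \<open>p(T) = q(T) (T - z)\<close>: passing from \<open>f\<close> to
  \<open>(T - z) f\<close> lowers the degree by one, which drives the induction in the continuation
  step.\<close>

lemma annihilates_linear_factor:
  assumes "annihilates k ([:-z, 1:] * q) f" "q \<noteq> 0"
  shows "annihilates k q (\<lambda>n. residue_sum k f n - z * f n)"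
  unfolding annihilates_def
proof
  fix n
  let ?F = "\<lambda>i. (residue_sum k ^^ i) f n"
  let ?p = "[:-z, 1:] * q"
  have deg: "degree ?p = Suc (degree q)"
    using assms(2) by (subst degree_mult_eq) auto
  have "0 = (\<Sum>i\<le>Suc (degree q). coeff ?p i * ?F i)"
    using assms(1) unfolding annihilates_def deg by simp
  \<comment> \<open>The coefficients of the product are those of \<open>q\<close> moved up by one
    place, minus \<open>z\<close> times those of \<open>q\<close>.\<close>
  also have "\<dots> = (\<Sum>i\<le>Suc (degree q). coeff (pCons 0 q) i * ?F i) - z * (\<Sum>i\<le>Suc (degree q). coeff q i * ?F i)"
    unfolding sum_distrib_left sum_subtractf[symmetric]
    by (intro sum.cong refl) (simp add: algebra_simps)
  also have "(\<Sum>i\<le>Suc (degree q). coeff (pCons 0 q) i * ?F i) = (\<Sum>i\<le>degree q. coeff q i * ?F (Suc i))"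
    by (subst sum.atMost_Suc_shift) simp
  also have "(\<Sum>i\<le>Suc (degree q). coeff q i * ?F i) = (\<Sum>i\<le>degree q. coeff q i * ?F i)"
    by (simp add: coeff_eq_0)
  also have "(\<Sum>i\<le>degree q. coeff q i * ?F (Suc i)) - z * (\<Sum>i\<le>degree q. coeff q i * ?F i) =
     (\<Sum>i\<le>degree q. coeff q i * (residue_sum k ^^ i) (\<lambda>n. residue_sum k f n - z * f n) n)"
    unfolding residue_sum_funpow_linear sum_distrib_left sum_subtractf[symmetric]
    by (intro sum.cong refl) (simp add: algebra_simps funpow_swap1)
  finally show "(\<Sum>i\<le>degree q. coeff q i * (residue_sum k ^^ i) (\<lambda>n. residue_sum k f n - z * f n) n) = 0"
    by simp
qed

text \<open>A family of \<open>card K + 1\<close> vectors in a space of dimension at most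
  \<open>card K\<close> is dependent. Dependence is a property of the set of vectors, so a repeated
  vector is treated separately, by the relation \<open>F i - F j = 0\<close>.\<close>

lemma finite_span_linear_relation:
  fixes F :: "nat \<Rightarrow> nat \<Rightarrow> complex"
  assumes K: "finite K" and F: "\<And>i. F i \<in> seq.span K"
  shows "\<exists>c. (\<exists>i\<le>card K. c i \<noteq> 0) \<and> (\<forall>n. (\<Sum>i\<le>card K. c i * F i n) = 0)"
proof (cases "inj_on F {..card K}")
  case True
  let ?S = "F ` {..card K}"
  have "card ?S = Suc (card K)" using True by (simp add: card_image)
  hence "seq.dependent ?S"
    using seq.independent_span_bound[OF K, of ?S] F by auto
  then obtain u where u: "\<exists>v\<in>?S. u v \<noteq> 0" "(\<Sum>v\<in>?S. (\<lambda>n. u v * v n)) = 0"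
    by (auto simp: seq.dependent_finite)
  have "(\<Sum>i\<le>card K. u (F i) * F i n) = 0" for n
  proof -
    have "(\<Sum>i\<in>I. u (F i) * F i n) = (\<Sum>i\<in>I. (\<lambda>n. u (F i) * F i n)) n" for I
      by (induction I rule: infinite_finite_induct) auto
    also have "(\<Sum>i\<in>{..card K}. (\<lambda>n. u (F i) * F i n)) = 0"
      using u(2) by (simp add: sum.reindex[OF True])
    finally show ?thesis by simp
  qed
  thus ?thesis using u(1) by (intro exI[of _ "\<lambda>i. u (F i)"]) auto
next
  case False
  then obtain i j where ij: "i \<le> card K" "j \<le> card K" "i \<noteq> j" "F i = F j"
    by (auto simp: inj_on_def)
  let ?c = "\<lambda>l. (if l = i then 1 else 0) - (if l = j then 1 else (0::complex))"
  have "(\<Sum>l\<le>card K. ?c l * F l n) = 0" for n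
  proof -
    have "(\<Sum>l\<le>card K. ?c l * F l n) =
        (\<Sum>l\<le>card K. (if l = i then F l n else 0)) - (\<Sum>l\<le>card K. (if l = j then F l n else 0))"
      unfolding sum_subtractf[symmetric] by (intro sum.cong) auto
    also have "\<dots> = F i n - F j n" using ij by simp
    finally show ?thesis using ij by simp
  qed
  thus ?thesis using ij by (intro exI[of _ ?c] conjI exI[of _ i]) auto
qed

text \<open>The iterates of \<open>residue_sum k\<close> on \<open>f\<close> up to order
  \<open>card K\<close> all lie in the span; a linear relation between them is the
  polynomial.\<close>

lemma annihilating_poly_exists:
  assumes K: "finite K"
    and closed: "\<And>f. f \<in> seq.span K \<Longrightarrow> residue_sum k f \<in> seq.span K" and f: "f \<in> seq.span K"
  shows "\<exists>p. p \<noteq> 0 \<and> annihilates k p f"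
proof -
  have "(residue_sum k ^^ i) f \<in> seq.span K" for i
    by (induction i) (auto intro: closed f)
  from finite_span_linear_relation[OF K, of "\<lambda>i. (residue_sum k ^^ i) f", OF this]
  obtain c where c: "\<exists>i\<le>card K. c i \<noteq> 0" "\<And>n. (\<Sum>i\<le>card K. c i * (residue_sum k ^^ i) f n) = 0"
    by blast
  define p where "p = (\<Sum>i\<le>card K. monom (c i) i)"
  have p: "coeff p j = (if j \<le> card K then c j else 0)" for j
    by (simp add: p_def coeff_sum)
  have deg: "degree p \<le> card K"
    by (rule degree_le) (simp add: p)
  have "p \<noteq> 0" using c(1) p by (metis coeff_0)
  moreover have "(\<Sum>i\<le>degree p. coeff p i * (residue_sum k ^^ i) f n) = 0" for n
  proof -
    have "(\<Sum>i\<le>degree p. coeff p i * (residue_sum k ^^ i) f n) =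
        (\<Sum>i\<le>card K. coeff p i * (residue_sum k ^^ i) f n)"
      using deg by (intro sum.mono_neutral_left) (auto simp: coeff_eq_0)
    thus ?thesis using c(2)[of n] by (simp add: p)
  qed
  ultimately show ?thesis unfolding annihilates_def by blast
qed

section \<open>Continuation of regular Dirichlet series\<close>

text \<open>Far to the right the modulus of \<open>k powr s\<close> exceeds \<open>norm z\<close>;
  the threshold comes from \<open>x < exp x\<close>.\<close>

lemma one_minus_powr_nonzero_right:
  fixes k :: nat and z :: complex
  assumes "k \<ge> 2"
  shows "\<exists>b. \<forall>s. Re s > b \<longrightarrow> 1 - z * of_nat k powr (-s) \<noteq> 0"
proof (intro exI allI impI)
  fix s :: complex assume s: "Re s > norm z / ln (real k)"
  have ln: "ln (real k) > 0" using assms by simp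
  have "norm z < Re s * ln (real k)" using s ln by (simp add: field_simps)
  also have "\<dots> < exp (Re s * ln (real k))" using exp_ge_add_one_self[of "Re s * ln (real k)"] by linarith
  also have "\<dots> = norm (of_nat k powr s :: complex)"
    using assms norm_powr_real_powr[of "of_nat k" s] by (simp add: powr_def)
  finally have "of_nat k powr s \<noteq> z" by auto
  thus "1 - z * of_nat k powr (-s) \<noteq> 0"
    using assms by (auto simp: powr_minus field_simps)
qed

text \<open>Moves the boundary one unit to the left, by induction on the degree of \<open>p\<close>.
  \<open>IH\<close> covers the whole span because the decimations of \<open>f\<close> enter, with
  shifts \<open>j \<ge> 1\<close>. As \<open>P\<close> is stable under translation to the left by
  integers, the same set serves at every stage.\<close>

lemma dirichlet_series_continuation_step:
  fixes \<Lambda> :: "complex set"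
  assumes k: "k \<ge> 2"
    and closed: "\<And>f r. r < k \<Longrightarrow> f \<in> seq.span K \<Longrightarrow> decimate k r f \<in> seq.span K"
    and growth: "\<And>f. f \<in> seq.span K \<Longrightarrow> growth_bound A f"
  defines "P \<equiv> {s. \<exists>l::nat. of_nat k powr (s + of_nat l) \<in> \<Lambda>}"
  assumes IH: "\<And>f. f \<in> seq.span K \<Longrightarrow> continuable (half_plane (real A + 1 - real N)) P (dirichlet_series f)"
    and "f \<in> seq.span K" "p \<noteq> 0" "annihilates k p f" "\<And>z. poly p z = 0 \<Longrightarrow> z \<noteq> 0 \<Longrightarrow> z \<in> \<Lambda>"
  shows "continuable (half_plane (real A + 1 - real (Suc N))) P (dirichlet_series f)"
  using assms(6-)
proof (induction "degree p" arbitrary: p f)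
  case 0
  then obtain c where c: "p = [:c:]" "c \<noteq> 0"
    by (metis degree_eq_zeroE pCons_0_0)
  hence "f = (\<lambda>_. 0)" using 0 by (simp add: annihilates_def fun_eq_iff)
  hence "dirichlet_series f = (\<lambda>_. 0)" by (simp add: dirichlet_series_def fun_eq_iff)
  thus ?case by (auto intro!: continuable_holomorphic)
next
  case (Suc d)
  let ?U = "half_plane (real A + 1 - real (Suc N))"
  obtain z where z: "poly p z = 0"
    using Suc.hyps(2) Fundamental_Theorem_Algebra.fundamental_theorem_of_algebra[of p] by (auto simp: constant_degree)
  then obtain q where q: "p = [:-z, 1:] * q" by (auto simp: poly_eq_0_iff_dvd)
  have q0: "q \<noteq> 0" using q Suc.prems by auto
  define g where "g = (\<lambda>n. residue_sum k f n - z * f n)"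
  have T: "residue_sum k f \<in> seq.span K"
    by (rule residue_sum_span[OF closed]) (use Suc.prems in auto)
  have gK: "g \<in> seq.span K"
  proof -
    have "g = residue_sum k f - (\<lambda>n. z * f n)" by (simp add: g_def fun_eq_iff)
    thus ?thesis using T Suc.prems by (simp only: seq.span_diff seq.span_scale)
  qed
  have "degree p = Suc (degree q)"
    using q0 unfolding q by (subst degree_mult_eq) auto
  hence cg: "continuable ?U P (dirichlet_series g)"
    using Suc.prems Suc.hyps(2) q0 q gK unfolding g_def
    by (intro Suc.hyps(1)[of q]) (auto intro: annihilates_linear_factor)
  obtain E where E: "E holomorphic_on ?U" "\<And>s. Re s > real A + 1 \<Longrightarrow> dirichlet_series f s =
       of_nat k powr (-s) * dirichlet_series (residue_sum k f) s + E s +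
       of_nat k powr (-s) * (\<Sum>r<k. \<Sum>j\<in>{1..N}. ((-s) gchoose j) * (of_nat r / of_nat k) ^ j *
           dirichlet_series (decimate k r f) (s + of_nat j))"
    using dirichlet_functional_equation[OF growth k, of f N] Suc.prems by blast
  \<comment> \<open>This is the right-hand side of the functional equation with \<open>g\<close> in
    place of \<open>residue_sum k f\<close>; the part \<open>z k^-s D_f\<close> left over goes to
    the other side, so \<open>h = (1 - z k^-s) D_f\<close> far to the right.\<close>
  define h where "h = (\<lambda>s. of_nat k powr (-s) * dirichlet_series g s + E s +
       of_nat k powr (-s) * (\<Sum>r<k. \<Sum>j\<in>{1..N}. ((-s) gchoose j) * (of_nat r / of_nat k) ^ j *
           dirichlet_series (decimate k r f) (s + of_nat j)))"
  have pw: "(\<lambda>s. of_nat k powr (-s) :: complex) holomorphic_on X" for X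
    using k by (intro holomorphic_intros) auto
  have "continuable ?U P h"
    unfolding h_def
  proof (intro continuable_add continuable_mult continuable_sum cg)
    fix r j assume r: "r \<in> {..<k}" and j: "j \<in> {1..N}"
    show "continuable ?U P (\<lambda>s. dirichlet_series (decimate k r f) (s + of_nat j))"
    proof (rule continuable_shift[OF IH])
      show "decimate k r f \<in> seq.span K" using r Suc.prems by (intro closed) auto
      show "s + of_nat j \<in> half_plane (real A + 1 - real N)" if "s \<in> ?U" for s
        using that j by (auto simp: half_plane_def)
      show "s \<in> P" if "s + of_nat j \<in> P" for s
      proof -
        from that obtain l :: nat where "of_nat k powr (s + of_nat j + of_nat l) \<in> \<Lambda>"
          by (auto simp: P_def)
        hence "of_nat k powr (s + of_nat (j + l)) \<in> \<Lambda>" by (simp add: add.assoc)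
        thus ?thesis unfolding P_def by blast
      qed
    qed
  qed (intro continuable_holomorphic holomorphic_intros pw E(1) half_plane_open)+
  hence "continuable ?U P (\<lambda>s. h s / (1 - z * of_nat k powr (-s)))"
  proof (rule continuable_divide)
    show "(\<lambda>s. 1 - z * of_nat k powr (-s)) analytic_on ?U"
      by (subst analytic_on_open) (auto intro!: holomorphic_intros pw)
    show "1 - z * of_nat k powr (-s) \<noteq> 0" if "s \<in> ?U - P" for s
    proof
      assume "1 - z * of_nat k powr (-s) = 0"
      hence eq: "of_nat k powr s = z" using k by (simp add: powr_minus field_simps)
      \<comment> \<open>Powers of \<open>k\<close> never vanish, so a root 0 creates no pole and
        \<Lambda> has to contain the nonzero roots only.\<close>
      hence "z \<noteq> 0" using k by auto
      hence "z \<in> \<Lambda>" using Suc.prems z by blast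
      hence "s \<in> P" unfolding P_def using eq by (intro CollectI exI[of _ 0]) simp
      thus False using that by simp
    qed
  qed
  moreover obtain b where b: "\<And>s. Re s > b \<Longrightarrow> 1 - z * of_nat k powr (-s) \<noteq> 0"
    using one_minus_powr_nonzero_right[OF k] by blast
  have "dirichlet_series f s = h s / (1 - z * of_nat k powr (-s))" if s: "Re s > max b (real A + 1)" for s
  proof -
    \<comment> \<open>The combination of two sequences is put as a sum over the Booleans so that
      linearity for finite sums applies.\<close>
    have "dirichlet_series (\<lambda>n. \<Sum>i\<in>{True, False}. (if i then 1 else - z) * (if i then residue_sum k f else f) n) s =
       (\<Sum>i\<in>{True, False}. (if i then 1 else - z) * dirichlet_series (if i then residue_sum k f else f) s)"
      using s T Suc.prems growth by (intro dirichlet_series_sum[where A = A]) auto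
    hence Dg: "dirichlet_series g s = dirichlet_series (residue_sum k f) s - z * dirichlet_series f s"
      by (simp add: g_def)
    \<comment> \<open>Here \<open>x\<close>, \<open>t\<close> and \<open>y\<close> stand for the
      series of \<open>f\<close>, \<open>residue_sum k f\<close> and \<open>g\<close>, and
      \<open>u\<close> for \<open>k^-s\<close>.\<close>
    have alg: "x = u * t + e + u * S \<Longrightarrow> y = t - z * x \<Longrightarrow> u * y + e + u * S = x * (1 - z * u)"
      for x u t e S y :: complex
      by algebra
    have "Re s > real A + 1" using s by simp
    from alg[OF E(2)[OF this] Dg] have "h s = dirichlet_series f s * (1 - z * of_nat k powr (-s))"
      unfolding h_def .
    thus ?thesis using b[of s] s by simp
  qed
  ultimately show ?case by (rule continuable_cong)
qed

text \<open>The equation fixes \<open>s + l\<close> up to integer multiples of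
  \<open>2 pi i / ln k\<close>, which gives the base point \<open>w\<close>, the spacing
  \<open>c\<close> and the shift by \<open>l\<close>.\<close>

lemma powr_fibre_semi_lattice:
  fixes k :: nat and \<mu> :: complex
  assumes "k \<ge> 2" "\<mu> \<noteq> 0"
  shows "\<exists>L. left_semi_lattice L \<and> {s. \<exists>l::nat. of_nat k powr (s + of_nat l) = \<mu>} \<subseteq> L"
proof -
  define w where "w = Ln \<mu> / of_real (ln (real k))"
  define c where "c = 2 * pi / ln (real k)"
  define L where "L = {w + \<i> * of_real c * of_int m - of_nat l | (m :: int) (l :: nat). True}"
  have ln: "ln (real k) > 0" using assms by simp
  have "c > 0" using ln by (simp add: c_def)
  hence "left_semi_lattice L" unfolding left_semi_lattice_def L_def by blast
  moreover have "s \<in> L" if eq: "of_nat k powr (s + of_nat l) = \<mu>" for s and l :: nat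
  proof -
    have "exp ((s + of_nat l) * of_real (ln (real k))) = exp (Ln \<mu>)"
      using eq assms by (simp add: powr_def Ln_of_nat)
    then obtain m :: int where m: "(s + of_nat l) * of_real (ln (real k)) = Ln \<mu> + of_int (2 * m) * of_real pi * \<i>"
      by (auto simp: exp_eq)
    have "s = w + \<i> * of_real c * of_int m - of_nat l"
      using m ln by (simp add: w_def c_def field_simps)
    thus ?thesis unfolding L_def by blast
  qed
  ultimately show ?thesis by blast
qed

theorem theorem3p1:
  fixes k :: nat and v :: "nat \<Rightarrow> complex"
  assumes "k \<ge> 2" and "k_regular k v"
  shows "\<exists>(d :: nat) (V :: nat \<Rightarrow> nat \<Rightarrow> complex) (G :: complex \<Rightarrow> nat \<Rightarrow> complex) (\<L> :: complex set set).
           d \<ge> 1 \<and> (\<forall>n\<ge>1. V n 0 = v n) \<and>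
           dirichlet_vector d V G \<and>
           (\<forall>j<d. (\<lambda>s. G s j) nicely_meromorphic_on UNIV) \<and>
           finite \<L> \<and> (\<forall>L\<in>\<L>. left_semi_lattice L) \<and>
           (\<forall>j<d. \<forall>z. is_pole (\<lambda>s. G s j) z \<longrightarrow> z \<in> \<Union>\<L>)"
proof -
  note k = assms(1)
  obtain K where K: "finite K" "v \<in> seq.span K"
    and closed: "\<And>f r. r < k \<Longrightarrow> f \<in> seq.span K \<Longrightarrow> decimate k r f \<in> seq.span K"
    by (rule regular_kernel_finite_basis[OF assms(2)]) blast
  obtain A where growth: "\<And>f. f \<in> seq.span K \<Longrightarrow> growth_bound A f"
    using decimation_closed_growth[OF k K(1) closed] by blast
  have "\<exists>p. p \<noteq> 0 \<and> annihilates k p b" if "b \<in> K" for b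
    by (rule annihilating_poly_exists[OF K(1) residue_sum_span[OF closed] seq.span_base[OF that]])
  then obtain p where p: "\<And>b. b \<in> K \<Longrightarrow> p b \<noteq> 0" "\<And>b. b \<in> K \<Longrightarrow> annihilates k (p b) b"
    by metis
  \<comment> \<open>Only the basis elements contribute roots, which keeps \<Lambda> finite; 0 is
    removed because it has no logarithm to start a semi-lattice from.\<close>
  define \<Lambda> where "\<Lambda> = (\<Union>b\<in>K. {z. poly (p b) z = 0}) - {0}"
  have fin\<Lambda>: "finite \<Lambda>"
    unfolding \<Lambda>_def using K(1) p(1) by (auto intro!: poly_roots_finite)
  define P where "P = {s. \<exists>l::nat. of_nat k powr (s + of_nat l) \<in> \<Lambda>}"
  have cont: "continuable (half_plane (real A + 1 - real N)) P (dirichlet_series f)"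
    if "f \<in> seq.span K" for N f
    using that
  proof (induction N arbitrary: f)
    case 0
    thus ?case
      using dirichlet_series_holomorphic[OF growth] by (auto intro!: continuable_holomorphic)
  next
    case (Suc N)
    \<comment> \<open>The step is applied to basis elements, whose annihilators have their nonzero
      roots in \<Lambda>; the rest of the span follows by linearity.\<close>
    have basis: "continuable (half_plane (real A + 1 - real (Suc N))) P (dirichlet_series b)" if "b \<in> K" for b
      unfolding P_def
    proof (rule dirichlet_series_continuation_step[OF k closed growth])
      show "continuable (half_plane (real A + 1 - real N)) {s. \<exists>l::nat. of_nat k powr (s + of_nat l) \<in> \<Lambda>}
          (dirichlet_series f)" if "f \<in> seq.span K" for f
        using Suc.IH[OF that] unfolding P_def .
      show "z \<in> \<Lambda>" if "poly (p b) z = 0" "z \<noteq> 0" for z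
        using that \<open>b \<in> K\<close> by (auto simp: \<Lambda>_def)
    qed (use that p in \<open>auto intro: seq.span_base\<close>)
    obtain c where c: "f = (\<lambda>n. \<Sum>b\<in>K. c b * b n)"
      using span_imp_linear_combination[OF K(1) Suc.prems] by blast
    have "continuable (half_plane (real A + 1 - real (Suc N))) P (\<lambda>s. \<Sum>b\<in>K. c b * dirichlet_series b s)"
      by (intro continuable_sum continuable_mult basis continuable_holomorphic holomorphic_intros half_plane_open)
    thus ?case
    proof (rule continuable_cong)
      show "dirichlet_series f s = (\<Sum>b\<in>K. c b * dirichlet_series b s)" if "Re s > real A + 1" for s
        unfolding c by (rule dirichlet_series_sum[OF _ that]) (auto intro!: growth seq.span_base)
    qed
  qed
  obtain g a where g: "g nicely_meromorphic_on UNIV" "\<And>z. is_pole g z \<Longrightarrow> z \<in> P"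
      "\<And>s. Re s > a \<Longrightarrow> g s = dirichlet_series v s"
    using continuable_half_planes_imp_nicely_meromorphic[OF cont[OF K(2)] dirichlet_series_holomorphic[OF growth[OF K(2)]]]
    by blast
  have "\<forall>\<mu>\<in>\<Lambda>. \<exists>L. left_semi_lattice L \<and> {s. \<exists>l::nat. of_nat k powr (s + of_nat l) = \<mu>} \<subseteq> L"
    using powr_fibre_semi_lattice[OF k] by (auto simp: \<Lambda>_def)
  then obtain L where L: "\<And>\<mu>. \<mu> \<in> \<Lambda> \<Longrightarrow> left_semi_lattice (L \<mu>)"
      "\<And>\<mu>. \<mu> \<in> \<Lambda> \<Longrightarrow> {s. \<exists>l::nat. of_nat k powr (s + of_nat l) = \<mu>} \<subseteq> L \<mu>"
    by metis
  have "P \<subseteq> \<Union>(L ` \<Lambda>)" using L(2) unfolding P_def by blast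
  \<comment> \<open>The series of \<open>v\<close> has been continued by itself, so a vector with
    one component suffices.\<close>
  moreover have "dirichlet_vector 1 (\<lambda>n _. v n) (\<lambda>s _. g s)"
    unfolding dirichlet_vector_def
  proof (intro exI allI impI)
    fix s :: complex and j assume s: "Re s > max a (real A + 1)"
    have "(\<lambda>n. v n * of_nat n powr (-s)) sums g s"
      using dirichlet_series_sums[OF growth[OF K(2)], of s] s g(3)[of s] by simp
    \<comment> \<open>The term at index 0 is 0, so starting at 1 leaves the sum unchanged.\<close>
    thus "(\<lambda>n. v (Suc n) * of_nat (Suc n) powr (-s)) sums g s"
      by (subst sums_Suc_iff) simp
  qed
  ultimately show ?thesis
    using g(1) fin\<Lambda> L(1)
    by (intro exI[of _ "1 :: nat"] exI[of _ "\<lambda>n _. v n"] exI[of _ "\<lambda>s _. g s"] exI[of _ "L ` \<Lambda>"])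
      (auto dest!: g(2))
qed

end
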